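(* Let $m\in\mathbb{Z}^+$, let $\lambda_0,\dots,\lambda_{m-1},c_0,\dots,c_{m-1}\in\mathbb{R}$, let $X=\{0,1\}^{\mathbb{Z}}$ and $\Omega=\mathbb{Z}_m\times X$, and let $T:\Omega\to\Omega$, $T(k,x)=(k+1 \bmod m,\,T_1x)$, where $(T_1x)_n=x_{n+1}$ is the left shift. For $E\in\mathbb{R}$ define $A_E:\Omega\to SL(2,\mathbb{R})$ by $$A_E(k,x)=\begin{bmatrix}E-\lambda_kx_0-c_k & -1\\ 1 & 0\end{bmatrix},$$ and for $n\in\mathbb{Z}^+$ and $\omega\in\Omega$ put $A^n_{E,\omega}=A_E(T^{n-1}\omega)\cdots A_E(T\omega)A_E(\omega)$ (so that $A^n_{E,(0,x)}=A(n-1)\cdots A(0)$ with $A(j)=\begin{bmatrix}E-V_x(j)&-1\\1&0\end{bmatrix}$, $V_x(j)=\lambda_{j\bmod m}x_j+c_{j\bmod m}$). Then for every $E\in\mathbb{R}$, the cocycle $(T,A_E)$ is uniformly hyperbolic if and only if the finite set of matrices $\{M: M=A^m_{E,(0,x)}\text{ for some }x\in X\}$ is uniformly hyperbolic.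
   Context: The cocycle $(T,A_E)$ is the map $\Omega\times\mathbb{R}^2\to\Omega\times\mathbb{R}^2$, $(\omega,v)\mapsto(T\omega,A_E(\omega)v)$. The cocycle is uniformly hyperbolic if there exist $\lambda>1$ and $C>0$ such that $\|A^n_{E,\omega}\|>C\lambda^n$ for all $n\in\mathbb{Z}^+$ and all $\omega\in\Omega$. A set of matrices $\mathcal{S}\subset SL(2,\mathbb{R})$ is uniformly hyperbolic if there exists $\lambda>1$ such that for every $n\ge1$ and every product $M_{1}M_{2}\cdots M_{n}$ of $n$ matrices from $\mathcal{S}$ (repetitions allowed), $\|M_1\cdots M_n\|>\lambda^n$. *)

theory Defs
  imports "HOL-Analysis.Analysis"
begin

text \<open>X = {0,1}^Z is modelled as int \<Rightarrow> bool (x_n = of_bool (x n)).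
  Omega = Z_m \<times> X is modelled as pairs (k, x) with k :: nat, k < m.\<close>

type_synonym omega = "nat \<times> (int \<Rightarrow> bool)"

definition Omega :: "nat \<Rightarrow> omega set" where
  "Omega m = {(k, x). k < m}"

definition shiftT :: "nat \<Rightarrow> omega \<Rightarrow> omega" where
  "shiftT m w = ((fst w + 1) mod m, (\<lambda>n. snd w (n + 1)))"

definition mat2 :: "real \<Rightarrow> real \<Rightarrow> real \<Rightarrow> real \<Rightarrow> real^2^2" where
  "mat2 a b c d = (\<chi> i j. if i = 1 then (if j = 1 then a else b) else (if j = 1 then c else d))"

definition A_mat :: "(nat \<Rightarrow> real) \<Rightarrow> (nat \<Rightarrow> real) \<Rightarrow> real \<Rightarrow> omega \<Rightarrow> real^2^2" where
  "A_mat lam c E w = mat2 (E - lam (fst w) * of_bool (snd w 0) - c (fst w)) (-1) 1 0"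

text \<open>cocycle_pow m lam c E n w = A_E(T^{n-1} w) ... A_E(T w) A_E(w)\<close>
fun cocycle_pow :: "nat \<Rightarrow> (nat \<Rightarrow> real) \<Rightarrow> (nat \<Rightarrow> real) \<Rightarrow> real \<Rightarrow> nat \<Rightarrow> omega \<Rightarrow> real^2^2" where
  "cocycle_pow m lam c E 0 w = mat 1"
| "cocycle_pow m lam c E (Suc n) w = A_mat lam c E ((shiftT m ^^ n) w) ** cocycle_pow m lam c E n w"

text \<open>Operator norm of a matrix (induced by the Euclidean norm).\<close>
definition mnorm :: "real^2^2 \<Rightarrow> real" where
  "mnorm M = onorm (\<lambda>v. M *v v)"

definition cocycle_UH :: "nat \<Rightarrow> (nat \<Rightarrow> real) \<Rightarrow> (nat \<Rightarrow> real) \<Rightarrow> real \<Rightarrow> bool" where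
  "cocycle_UH m lam c E \<longleftrightarrow>
     (\<exists>l C. l > 1 \<and> C > 0 \<and>
        (\<forall>n\<ge>1. \<forall>w\<in>Omega m. mnorm (cocycle_pow m lam c E n w) > C * l ^ n))"

definition matrix_set_UH :: "(real^2^2) set \<Rightarrow> bool" where
  "matrix_set_UH S \<longleftrightarrow>
     (\<exists>l. l > 1 \<and> (\<forall>n\<ge>1. \<forall>Ms. length Ms = n \<and> set Ms \<subseteq> S \<longrightarrow>
        mnorm (foldr (**) Ms (mat 1)) > l ^ n))"

end

theory Submission
  imports Defs
begin

text \<open>A product of \<open>q\<close> matrices from the set \<open>S\<close> of \<open>m\<close>-step transfer matrices is exactly
  the \<open>qm\<close>-step cocycle at a point \<open>(0, z)\<close>, because the cocycle at \<open>(0, x)\<close> only depends on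
  finitely many coordinates of \<open>x\<close>, which can be concatenated freely.
  If the cocycle is uniformly hyperbolic, make \<open>z\<close> periodic: the cocycle along the periodic
  orbit is a power of the product \<open>P\<close>, so \<open>C \<lambda>\<^bsup>kN\<^esup> < \<parallel>P\<parallel>\<^sup>k\<close> for all \<open>k\<close>, forcing
  \<open>\<parallel>P\<parallel> \<ge> \<lambda>\<^sup>N\<close>. Conversely, an orbit segment starting at \<open>(k, x)\<close> is embedded in a product of
  blocks starting at phase \<open>0\<close> by adding at most \<open>m\<close> steps on each side, which changes
  the norm by at most a bounded factor.\<close>

fun cocycle :: "('a \<Rightarrow> 'a) \<Rightarrow> ('a \<Rightarrow> real^'n^'n) \<Rightarrow> nat \<Rightarrow> 'a \<Rightarrow> real^'n^'n" where
  "cocycle T A 0 w = mat 1"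
| "cocycle T A (Suc n) w = A ((T ^^ n) w) ** cocycle T A n w"

lemma cocycle_add:
  "cocycle T A (a + b) w = cocycle T A b ((T ^^ a) w) ** cocycle T A a w"
proof (induction b)
  case 0
  then show ?case by (simp add: matrix_mul_lid)
next
  case (Suc b)
  have "(T ^^ (a + b)) w = (T ^^ b) ((T ^^ a) w)"
    by (subst add.commute) (simp add: funpow_add)
  with Suc show ?case by (simp add: matrix_mul_assoc)
qed

lemma mnorm_nonneg: "0 \<le> mnorm M"
  unfolding mnorm_def by (rule onorm_pos_le) simp

lemma mnorm_matrix_mul_le: "mnorm (A ** B) \<le> mnorm A * mnorm B"
proof -
  have "(\<lambda>v. (A ** B) *v v) = (\<lambda>v. A *v v) \<circ> (\<lambda>v. B *v v)"
    by (simp add: fun_eq_iff matrix_vector_mul_assoc)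
  then show ?thesis
    unfolding mnorm_def by (metis onorm_compose matrix_vector_mul_bounded_linear)
qed

lemma mnorm_mat_1_le: "mnorm (mat 1) \<le> 1"
proof -
  have "(*v) (mat 1 :: real^2^2) = (\<lambda>x. x)"
    by (rule ext) (simp add: matrix_vector_mul_lid)
  then show ?thesis unfolding mnorm_def by (simp add: onorm_id_le)
qed

lemma mnorm_cocycle_le_power:
  assumes "\<And>j. mnorm (A ((T ^^ j) w)) \<le> K"
  shows "mnorm (cocycle T A n w) \<le> K ^ n"
proof (induction n)
  case 0
  then show ?case using mnorm_mat_1_le by simp
next
  case (Suc n)
  have "mnorm (cocycle T A (Suc n) w) \<le> mnorm (A ((T ^^ n) w)) * mnorm (cocycle T A n w)"
    by (simp add: mnorm_matrix_mul_le)
  also have "\<dots> \<le> K * K ^ n"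
    using Suc assms[of n] by (intro mult_mono) (auto intro: order_trans mnorm_nonneg)
  finally show ?case by simp
qed

lemma mnorm_cocycle_extend_le:
  assumes "\<And>j. mnorm (A ((T ^^ j) w)) \<le> K"
  shows "mnorm (cocycle T A (k + n + s) w) \<le> K ^ (k + s) * mnorm (cocycle T A n ((T ^^ k) w))"
proof -
  have K0: "0 \<le> K" using assms[of 0] mnorm_nonneg order_trans by blast
  have after: "mnorm (cocycle T A s ((T ^^ (k + n)) w)) \<le> K ^ s"
  proof (rule mnorm_cocycle_le_power)
    show "mnorm (A ((T ^^ j) ((T ^^ (k + n)) w))) \<le> K" for j
      using assms[of "j + (k + n)"] by (simp add: funpow_add)
  qed
  have before: "mnorm (cocycle T A k w) \<le> K ^ k"
    using assms by (rule mnorm_cocycle_le_power)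
  have "cocycle T A (k + n + s) w =
      cocycle T A s ((T ^^ (k + n)) w) ** (cocycle T A n ((T ^^ k) w) ** cocycle T A k w)"
    by (simp only: cocycle_add)
  then have "mnorm (cocycle T A (k + n + s) w) \<le>
      K ^ s * (mnorm (cocycle T A n ((T ^^ k) w)) * K ^ k)"
    using after before K0 mnorm_nonneg mnorm_matrix_mul_le
    by (smt (verit) mult_left_mono mult_mono zero_le_power)
  then show ?thesis by (simp add: power_add mult_ac)
qed

lemma mnorm_cocycle_periodic_le:
  assumes "(T ^^ N) w = w"
  shows "mnorm (cocycle T A (k * N) w) \<le> mnorm (cocycle T A N w) ^ k"
proof (induction k)
  case 0
  then show ?case using mnorm_mat_1_le by simp
next
  case (Suc k)
  have "(T ^^ (k * N)) w = w"
    using assms by (induction k) (simp_all add: funpow_add)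
  then have "cocycle T A (Suc k * N) w = cocycle T A N w ** cocycle T A (k * N) w"
    using cocycle_add[of T A "k * N" N w] by (simp add: add.commute)
  then have "mnorm (cocycle T A (Suc k * N) w) \<le>
      mnorm (cocycle T A N w) * mnorm (cocycle T A (k * N) w)"
    by (simp add: mnorm_matrix_mul_le)
  also have "\<dots> \<le> mnorm (cocycle T A N w) * mnorm (cocycle T A N w) ^ k"
    using Suc.IH mnorm_nonneg by (rule mult_left_mono)
  finally show ?case by simp
qed

lemma le_if_mult_power_less:
  fixes a b C :: real
  assumes "C > 0" "0 \<le> b" and less: "\<And>k. k \<ge> 1 \<Longrightarrow> C * a ^ k < b ^ k"
  shows "a \<le> b"
proof (rule ccontr)
  assume "\<not> a \<le> b"
  then have "b < a" "0 < a" using \<open>0 \<le> b\<close> by auto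
  define r where "r = b / a"
  have "0 \<le> r" "r < 1" using \<open>b < a\<close> \<open>0 < a\<close> \<open>0 \<le> b\<close> by (auto simp: r_def)
  then have "(\<lambda>k. r ^ k) \<longlonglongrightarrow> 0" by (intro LIMSEQ_power_zero) simp
  then have "eventually (\<lambda>k. r ^ k < C) sequentially"
    using \<open>C > 0\<close> by (rule order_tendstoD(2))
  then obtain k where "k \<ge> 1" "r ^ k < C"
    unfolding eventually_sequentially by (metis le_add2 le_add1)
  then have "b ^ k < C * a ^ k"
    using \<open>0 < a\<close> by (simp add: r_def power_divide divide_less_eq)
  with less[OF \<open>k \<ge> 1\<close>] show False by simp
qed

lemma power_le_mnorm_cocycle_periodic:
  assumes "C > 0" and growth: "\<And>n. n \<ge> 1 \<Longrightarrow> C * l ^ n < mnorm (cocycle T A n w)"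
    and "(T ^^ N) w = w" "N \<ge> 1"
  shows "l ^ N \<le> mnorm (cocycle T A N w)"
proof (rule le_if_mult_power_less[OF \<open>C > 0\<close> mnorm_nonneg])
  fix k :: nat assume "k \<ge> 1"
  then have "C * (l ^ N) ^ k < mnorm (cocycle T A (k * N) w)"
    using growth[of "k * N"] \<open>N \<ge> 1\<close> by (simp add: power_mult mult.commute)
  also have "\<dots> \<le> mnorm (cocycle T A N w) ^ k"
    using \<open>(T ^^ N) w = w\<close> by (rule mnorm_cocycle_periodic_le)
  finally show "C * (l ^ N) ^ k < mnorm (cocycle T A N w) ^ k" .
qed

lemma cocycle_pow_eq_cocycle: "cocycle_pow m lam c E = cocycle (shiftT m) (A_mat lam c E)"
proof (intro ext)
  show "cocycle_pow m lam c E n w = cocycle (shiftT m) (A_mat lam c E) n w" for n w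
    by (induction n) simp_all
qed

lemma cocycle_pow_add:
  "cocycle_pow m lam c E (a + b) w =
   cocycle_pow m lam c E b ((shiftT m ^^ a) w) ** cocycle_pow m lam c E a w"
  unfolding cocycle_pow_eq_cocycle by (rule cocycle_add)

lemma funpow_shiftT:
  assumes "k < m"
  shows "(shiftT m ^^ a) (k, x) = ((k + a) mod m, \<lambda>n. x (n + int a))"
proof (induction a)
  case 0
  then show ?case using assms by (simp add: fun_eq_iff)
next
  case (Suc a)
  then show ?case
    by (simp add: shiftT_def mod_Suc_eq add_ac)
qed

lemma funpow_shiftT_in_Omega: "w \<in> Omega m \<Longrightarrow> (shiftT m ^^ j) w \<in> Omega m"
  by (induction j) (auto simp: Omega_def shiftT_def)

lemma A_mat_mnorm_bounded: "\<exists>K\<ge>1. \<forall>w\<in>Omega m. mnorm (A_mat lam c E w) \<le> K"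
proof -
  define B where "B = 1 + (\<Sum>k<m. \<bar>E\<bar> + \<bar>lam k\<bar> + \<bar>c k\<bar>)"
  have "1 \<le> B" by (simp add: B_def sum_nonneg)
  have "mnorm (A_mat lam c E w) \<le> 4 * B" if "w \<in> Omega m" for w
  proof -
    have "\<bar>E\<bar> + \<bar>lam (fst w)\<bar> + \<bar>c (fst w)\<bar> \<le> (\<Sum>k<m. \<bar>E\<bar> + \<bar>lam k\<bar> + \<bar>c k\<bar>)"
      using that by (intro member_le_sum) (auto simp: Omega_def)
    moreover have "\<bar>lam (fst w) * of_bool (snd w 0)\<bar> \<le> \<bar>lam (fst w)\<bar>"
      by (simp add: abs_mult)
    ultimately have "\<bar>E - lam (fst w) * of_bool (snd w 0) - c (fst w)\<bar> \<le> B"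
      unfolding B_def by linarith
    with \<open>1 \<le> B\<close> have "\<And>i j. \<bar>A_mat lam c E w $ i $ j\<bar> \<le> B"
      by (simp add: A_mat_def mat2_def)
    then have "onorm ((*v) (A_mat lam c E w)) \<le> real CARD(2) * real CARD(2) * B"
      by (rule onorm_le_matrix_component)
    then show ?thesis by (simp add: mnorm_def)
  qed
  with \<open>1 \<le> B\<close> show ?thesis by (intro exI[of _ "4 * B"]) auto
qed

lemma cocycle_pow_local:
  assumes "k < m" and agree: "\<And>j. 0 \<le> j \<Longrightarrow> j < int N \<Longrightarrow> x j = y j"
  shows "cocycle_pow m lam c E N (k, x) = cocycle_pow m lam c E N (k, y)"
  using agree
proof (induction N)
  case 0
  then show ?case by simp
next
  case (Suc N)
  then have "x (int N) = y (int N)" by simp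
  with Suc show ?case by (simp add: funpow_shiftT[OF \<open>k < m\<close>] A_mat_def)
qed

abbreviation block_matrices :: "nat \<Rightarrow> (nat \<Rightarrow> real) \<Rightarrow> (nat \<Rightarrow> real) \<Rightarrow> real \<Rightarrow> (real^2^2) set" where
  "block_matrices m lam c E \<equiv> {M. \<exists>x. M = cocycle_pow m lam c E m (0, x)}"

lemma cocycle_pow_block_product:
  assumes "m \<ge> 1"
  shows "\<exists>Ms. length Ms = q \<and> set Ms \<subseteq> block_matrices m lam c E \<and>
    cocycle_pow m lam c E (q * m) (0, y) = foldr (**) Ms (mat 1)"
proof (induction q)
  case 0
  then show ?case by simp
next
  case (Suc q)
  then obtain Ms where Ms: "length Ms = q" "set Ms \<subseteq> block_matrices m lam c E"
    "cocycle_pow m lam c E (q * m) (0, y) = foldr (**) Ms (mat 1)"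
    by blast
  define M where "M = cocycle_pow m lam c E m (0, \<lambda>n. y (n + int (q * m)))"
  have "(shiftT m ^^ (q * m)) (0, y) = (0, \<lambda>n. y (n + int (q * m)))"
    using funpow_shiftT[of 0 m "q * m" y] assms by simp
  then have "cocycle_pow m lam c E (q * m + m) (0, y) = M ** foldr (**) Ms (mat 1)"
    by (simp only: cocycle_pow_add Ms(3) M_def)
  with Ms show ?case
    by (intro exI[of _ "M # Ms"]) (auto simp: M_def add.commute)
qed

lemma block_product_cocycle_pow:
  assumes "m \<ge> 1"
  shows "set Ms \<subseteq> block_matrices m lam c E \<Longrightarrow>
    \<exists>z. cocycle_pow m lam c E (length Ms * m) (0, z) = foldr (**) Ms (mat 1)"
proof (induction Ms)
  case Nil
  then show ?case by simp
next
  case (Cons M Ms)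
  then obtain z where z: "cocycle_pow m lam c E (length Ms * m) (0, z) = foldr (**) Ms (mat 1)"
    by auto
  obtain x where x: "M = cocycle_pow m lam c E m (0, x)" using Cons.prems by auto
  define L where "L = length Ms * m"
  define z' where "z' = (\<lambda>j. if j < int L then z j else x (j - int L))"
  have "0 < m" using assms by simp
  have "(shiftT m ^^ L) (0, z') = (0, \<lambda>n. z' (n + int L))"
    using funpow_shiftT[of 0 m L z'] \<open>0 < m\<close> by (simp add: L_def)
  moreover have "cocycle_pow m lam c E m (0, \<lambda>n. z' (n + int L)) = M"
    unfolding x by (rule cocycle_pow_local[OF \<open>0 < m\<close>]) (auto simp: z'_def)
  moreover have "cocycle_pow m lam c E L (0, z') = foldr (**) Ms (mat 1)"
    unfolding z[folded L_def, symmetric]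
    by (rule cocycle_pow_local[OF \<open>0 < m\<close>]) (auto simp: z'_def)
  ultimately have "cocycle_pow m lam c E (L + m) (0, z') = M ** foldr (**) Ms (mat 1)"
    by (simp only: cocycle_pow_add)
  then show ?case by (auto simp: L_def add.commute)
qed

lemma matrix_set_UH_if_cocycle_UH:
  assumes "m \<ge> 1" "cocycle_UH m lam c E"
  shows "matrix_set_UH (block_matrices m lam c E)"
proof -
  obtain l C where "l > 1" "C > 0" and growth: "\<And>n w. n \<ge> 1 \<Longrightarrow> w \<in> Omega m \<Longrightarrow>
      C * l ^ n < mnorm (cocycle_pow m lam c E n w)"
    using assms(2) unfolding cocycle_UH_def by blast
  have block_growth: "l ^ (q * m) \<le> mnorm (cocycle_pow m lam c E (q * m) (0, z))"
    if "q \<ge> 1" for q z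
  proof -
    define N where "N = q * m"
    define y where "y = (\<lambda>j. z (j mod int N))"
    have "0 < m" "N \<ge> 1" using assms(1) that by (simp_all add: N_def)
    have "cocycle_pow m lam c E N (0, y) = cocycle_pow m lam c E N (0, z)"
      by (rule cocycle_pow_local[OF \<open>0 < m\<close>]) (auto simp: y_def)
    moreover have "(shiftT m ^^ N) (0, y) = (0, y)"
      using funpow_shiftT[of 0 m N y] \<open>0 < m\<close> by (simp add: N_def y_def fun_eq_iff)
    then have "l ^ N \<le> mnorm (cocycle_pow m lam c E N (0, y))"
      using \<open>C > 0\<close> growth \<open>0 < m\<close> \<open>N \<ge> 1\<close> unfolding cocycle_pow_eq_cocycle
      by (intro power_le_mnorm_cocycle_periodic[where C = C]) (auto simp: Omega_def)
    ultimately show ?thesis by (simp add: N_def)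
  qed
  define l' where "l' = (1 + l) / 2"
  have "l' > 1" "l' < l" using \<open>l > 1\<close> by (auto simp: l'_def)
  have "l' ^ q < mnorm (foldr (**) Ms (mat 1))"
    if "q \<ge> 1" and len: "length Ms = q" and blocks: "set Ms \<subseteq> block_matrices m lam c E"
    for q Ms
  proof -
    obtain z where z: "cocycle_pow m lam c E (q * m) (0, z) = foldr (**) Ms (mat 1)"
      using block_product_cocycle_pow[OF assms(1) blocks] len by blast
    have "l' ^ q < l ^ q"
      using \<open>l' > 1\<close> \<open>l' < l\<close> \<open>q \<ge> 1\<close> by (intro power_strict_mono) auto
    also have "\<dots> \<le> l ^ (q * m)" using \<open>l > 1\<close> assms(1) by (intro power_increasing) auto
    also have "\<dots> \<le> mnorm (foldr (**) Ms (mat 1))"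
      using block_growth[OF \<open>q \<ge> 1\<close>, of z] z by simp
    finally show ?thesis .
  qed
  with \<open>l' > 1\<close> show ?thesis unfolding matrix_set_UH_def by blast
qed

lemma next_multiple:
  assumes "0 < (m::nat)"
  obtains q s where "a + s = Suc q * m" "s \<le> m"
proof
  have "a div m * m + a mod m = a" "a mod m < m"
    using assms by simp_all
  then show "a + (m - a mod m) = Suc (a div m) * m"
    unfolding mult_Suc by linarith
qed simp

lemma cocycle_UH_if_matrix_set_UH:
  assumes "m \<ge> 1" "matrix_set_UH (block_matrices m lam c E)"
  shows "cocycle_UH m lam c E"
proof -
  obtain l where "l > 1" and block_growth: "\<And>n Ms. n \<ge> 1 \<Longrightarrow> length Ms = n \<Longrightarrow>
      set Ms \<subseteq> block_matrices m lam c E \<Longrightarrow> l ^ n < mnorm (foldr (**) Ms (mat 1))"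
    using assms(2) unfolding matrix_set_UH_def by blast
  obtain K where "K \<ge> 1" and K: "\<And>w. w \<in> Omega m \<Longrightarrow> mnorm (A_mat lam c E w) \<le> K"
    using A_mat_mnorm_bounded by blast
  define l' where "l' = root m l"
  have "l' > 1" "l' ^ m = l" using \<open>l > 1\<close> assms(1) by (simp_all add: l'_def)
  have "1 / K ^ (2 * m) * l' ^ n < mnorm (cocycle_pow m lam c E n w)"
    if "n \<ge> 1" "w \<in> Omega m" for n w
  proof -
    obtain k x where w: "w = (k, x)" and "k < m" using \<open>w \<in> Omega m\<close> by (auto simp: Omega_def)
    define w0 where "w0 = (0::nat, \<lambda>j. x (j - int k))"
    have "w0 \<in> Omega m" using assms(1) by (simp add: w0_def Omega_def)
    have start: "(shiftT m ^^ k) w0 = w"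
      using funpow_shiftT[of 0 m k] \<open>k < m\<close> by (simp add: w0_def w)
    obtain q s where qs: "k + n + s = Suc q * m" "s \<le> m"
      by (rule next_multiple[of m]) (use assms(1) in auto)
    obtain Ms where "length Ms = Suc q" "set Ms \<subseteq> block_matrices m lam c E"
      "cocycle_pow m lam c E (Suc q * m) w0 = foldr (**) Ms (mat 1)"
      using cocycle_pow_block_product[OF assms(1), of "Suc q" lam c E "snd w0"]
      by (auto simp: w0_def)
    then have "l ^ Suc q < mnorm (cocycle_pow m lam c E (Suc q * m) w0)"
      using block_growth[of "Suc q"] by simp
    also have "\<dots> \<le> K ^ (k + s) * mnorm (cocycle_pow m lam c E n w)"
      unfolding qs(1)[symmetric] cocycle_pow_eq_cocycle start[symmetric]
      using K funpow_shiftT_in_Omega[OF \<open>w0 \<in> Omega m\<close>] by (intro mnorm_cocycle_extend_le) auto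
    also have "\<dots> \<le> K ^ (2 * m) * mnorm (cocycle_pow m lam c E n w)"
      using \<open>K \<ge> 1\<close> \<open>k < m\<close> qs(2) mnorm_nonneg
      by (intro mult_right_mono power_increasing) auto
    finally have "l ^ Suc q < K ^ (2 * m) * mnorm (cocycle_pow m lam c E n w)" .
    moreover have "l' ^ n \<le> l ^ Suc q"
    proof -
      have "l' ^ n \<le> l' ^ (k + n + s)" using \<open>l' > 1\<close> by (intro power_increasing) auto
      also have "\<dots> = (l' ^ m) ^ Suc q"
        by (simp only: qs(1) mult.commute[of "Suc q" m] power_mult)
      also have "\<dots> = l ^ Suc q"
        by (simp add: \<open>l' ^ m = l\<close>)
      finally show ?thesis .
    qed
    ultimately have "l' ^ n < K ^ (2 * m) * mnorm (cocycle_pow m lam c E n w)"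
      by linarith
    then show ?thesis
      using \<open>K \<ge> 1\<close> by (simp add: field_simps)
  qed
  with \<open>l' > 1\<close> \<open>K \<ge> 1\<close> show ?thesis unfolding cocycle_UH_def
    by (intro exI[of _ l'] exI[of _ "1 / K ^ (2 * m)"]) simp
qed

theorem lemma1:
  fixes m :: nat and lam c :: "nat \<Rightarrow> real" and E :: real
  assumes "m \<ge> 1"
  shows "cocycle_UH m lam c E \<longleftrightarrow>
         matrix_set_UH {M. \<exists>x. M = cocycle_pow m lam c E m (0, x)}"
  using matrix_set_UH_if_cocycle_UH[OF assms] cocycle_UH_if_matrix_set_UH[OF assms] by blast

end
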